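(* Let $q$ be an odd prime number, let $p \in \{q+1,\, 2q+1\}$, and let $A = \dfrac{p^q-1}{p-1}$. Then exactly one of the distinct prime divisors of $A$ is less than $p$, and $A$ has at least two different prime divisors.
   Context: The number $p$ is not assumed to be prime. *)

theory Defs
  imports Complex_Main "HOL-Computational_Algebra.Primes"
begin

end

theory Submission
  imports Defs "HOL-Number_Theory.Number_Theory"
begin

text \<open>Write \<open>A = 1 + p + \<dots> + p^(q-1)\<close> with \<open>p \<equiv> 1 (mod q)\<close>. A prime divisor \<open>r\<close> of \<open>A\<close> is
  either \<open>q\<close> or \<open>p\<close> has order \<open>q\<close> modulo \<open>r\<close>, so that \<open>r \<equiv> 1 (mod q)\<close>; the bound \<open>r < p\<close> leaves
  only \<open>r = q + 1\<close> with \<open>p = 2q + 1\<close>, which is even and exceeds 2. Expanding modulo \<open>q^2\<close> gives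
  \<open>A \<equiv> q (mod q^2)\<close>, so \<open>q\<close> divides \<open>A\<close> exactly once, and \<open>A > q\<close> forces another prime divisor.\<close>

lemma nat_geometric_sum:
  fixes p :: nat
  assumes "p > 1"
  shows "(p - 1) * (\<Sum>i<n. p ^ i) = p ^ n - 1"
proof -
  obtain k where k: "p = k + 1"
    using assms by (metis le_add_diff_inverse2 less_imp_le)
  have "k * (\<Sum>i<n. (k + 1) ^ i) + 1 = (k + 1) ^ n"
    by (induction n) (simp_all add: algebra_simps)
  thus ?thesis
    unfolding k by (metis add_diff_cancel_right')
qed

text \<open>The order of \<open>p\<close> modulo \<open>r\<close> divides the prime
  \<open>q\<close>. Order 1 turns every summand into 1 modulo \<open>r\<close>, so \<open>r\<close>
  divides \<open>q\<close>; order \<open>q\<close> has to divide \<open>r - 1\<close> by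
  Fermat.\<close>

lemma prime_dvd_geometric_sum:
  fixes p q r :: nat
  assumes "prime q" "prime r" "r dvd (\<Sum>i<q. p ^ i)" "p > 1"
  shows "r = q \<or> [r = 1] (mod q)"
proof -
  have "r dvd p ^ q - 1"
    using assms(3) nat_geometric_sum[OF assms(4), of q] by (metis dvd_mult)
  hence cong: "[p ^ q = 1] (mod r)"
    using assms(4) by (metis cong_to_1_nat cong_altdef_nat cong_sym one_le_power less_imp_le)
  hence "ord r p dvd q"
    by (simp only: ord_divides)
  then consider "ord r p = 1" | "ord r p = q"
    using assms(1) by (auto simp: prime_nat_iff)
  thus ?thesis
  proof cases
    case 1
    hence "[p = 1] (mod r)"
      using ord[of p r] by simp
    hence "[(\<Sum>i<q. p ^ i) = (\<Sum>i<q. 1 ^ i)] (mod r)"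
      by (intro cong_sum cong_pow)
    hence "r dvd q"
      using assms(3) by (simp add: cong_dvd_iff)
    thus ?thesis
      using assms(1,2) by (simp add: primes_dvd_imp_eq)
  next
    case 2
    \<comment> \<open>By convention \<open>ord r p\<close> is 0 when \<open>p\<close> and
      \<open>r\<close> are not coprime, whereas \<open>q\<close> is nonzero.\<close>
    have "coprime p r"
      using 2 assms(1) by (metis ord_eq_0 coprime_commute not_prime_0)
    hence "q dvd r - 1"
      using 2 order_divides_totient[of r p] assms(2)
      by (simp add: coprime_commute totient_prime)
    thus ?thesis
      using assms(2) by (metis cong_altdef_nat prime_ge_1_nat)
  qed
qed

text \<open>Since q^2 divides k^2, only the constant and linear terms of each binomial expansion
  survive. The linear terms add up to k q (q - 1)/2, a multiple of q^2 because (q - 1)/2 is an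
  integer for odd q.\<close>

lemma geometric_sum_cong_square:
  fixes q k :: nat
  assumes "odd q" "q dvd k"
  shows "[(\<Sum>i<q. (k + 1) ^ i) = q] (mod q ^ 2)"
proof -
  obtain c m where c: "k = q * c" and m: "q = 2 * m + 1"
    using assms by (auto elim!: dvdE oddE)
  have binom: "[(k + 1) ^ i = 1 + i * k] (mod q ^ 2)" for i
  proof (induction i)
    case (Suc i)
    have "[(k + 1) ^ Suc i = (k + 1) * (1 + i * k)] (mod q ^ 2)"
      unfolding power_Suc by (intro cong_scalar_left Suc.IH)
    also have "(k + 1) * (1 + i * k) = 1 + Suc i * k + q ^ 2 * (i * c ^ 2)"
      by (simp add: c algebra_simps power2_eq_square)
    also have "[\<dots> = 1 + Suc i * k] (mod q ^ 2)"
      by (simp add: cong_def)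
    finally show ?case .
  qed simp
  have gauss: "(\<Sum>i<2 * m + 1. i) = (2 * m + 1) * m"
    by (induction m) auto
  have "[(\<Sum>i<q. (k + 1) ^ i) = (\<Sum>i<q. 1 + i * k)] (mod q ^ 2)"
    by (intro cong_sum binom)
  also have "(\<Sum>i<q. 1 + i * k) = q + (\<Sum>i<q. i) * k"
    by (simp only: sum.distrib sum_distrib_right) simp
  also have "(\<Sum>i<q. i) = q * m"
    using gauss m by simp
  also have "q + q * m * k = q + q ^ 2 * (m * c)"
    by (simp add: c power2_eq_square)
  also have "[\<dots> = q] (mod q ^ 2)"
    by (simp add: cong_def)
  finally show ?thesis .
qed

theorem theorem4:
  fixes p q A :: nat
  assumes "prime q" and "odd q"
    and "p \<in> {q + 1, 2 * q + 1}"
    and "A = (p ^ q - 1) div (p - 1)"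
  shows "(\<exists>!r. prime r \<and> r dvd A \<and> r < p) \<and> card {r. prime r \<and> r dvd A} \<ge> 2"
proof -
  have q: "q > 2"
    using assms(1,2) prime_ge_2_nat[of q] by (cases "q = 2") auto
  have p: "p > 1" "q < p"
    using assms(3) q by auto
  have A: "A = (\<Sum>i<q. p ^ i)"
    using assms(4) p(1) nat_geometric_sum[OF p(1), of q, symmetric] by simp
  have "q dvd p - 1" "p = (p - 1) + 1"
    using assms(3) by auto
  hence sq: "[A = q] (mod q ^ 2)"
    using geometric_sum_cong_square[OF assms(2), of "p - 1"] A by simp
  have "[A = q] (mod q)"
    using sq by (rule cong_dvd_modulus_nat) (simp add: power2_eq_square)
  hence qA: "q dvd A"
    by (simp add: cong_dvd_iff)
  have uniq: "r = q" if r: "prime r" "r dvd A" "r < p" for r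
  proof (rule ccontr)
    assume "r \<noteq> q"
    hence "[r = 1] (mod q)"
      using prime_dvd_geometric_sum[OF assms(1) r(1) _ p(1)] r(2) A by auto
    hence "q dvd r - 1"
      by (metis cong_altdef_nat prime_ge_1_nat r(1))
    then obtain t where t: "r = q * t + 1"
      using prime_ge_1_nat[OF r(1)] by (metis dvdE le_add_diff_inverse2)
    have "t \<noteq> 0"
      using t r(1) by (metis add_0 mult_0_right not_prime_1)
    \<comment> \<open>With \<open>t\<close> at least 2, \<open>r\<close> would reach 2q + 1, the
      larger of the two values allowed for \<open>p\<close>.\<close>
    moreover have "t < 2"
    proof (rule ccontr)
      assume "\<not> t < 2"
      hence "q * 2 \<le> q * t" by simp
      thus False using t r(3) assms(3) by auto
    qed
    ultimately have "r = q + 1"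
      using t by (cases "t = 1") auto
    thus False
      using assms(2) q r(1) by (metis even_plus_one_iff less_add_one less_trans prime_odd_nat)
  qed
  have "\<not> q ^ 2 dvd q"
    using q by (auto dest!: dvd_imp_le simp: power2_eq_square)
  hence nsq: "\<not> q ^ 2 dvd A"
    using sq by (simp add: cong_dvd_iff)
  obtain m where m: "A = q * m"
    using qA by auto
  \<comment> \<open>Every summand is at least 1; the one at index 1 is \<open>p > 1\<close> and
    gives strictness.\<close>
  have "(\<Sum>i<q. 1) < (\<Sum>i<q. p ^ i)"
    using p q by (intro sum_strict_mono_ex1) (auto intro!: bexI[of _ 1])
  hence "A > q"
    using A by simp
  hence "m \<noteq> 1"
    using m by auto
  then obtain s where s: "prime s" "s dvd m"
    using prime_factor_nat by blast
  have "s \<noteq> q"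
    using nsq s(2) m by (auto simp: power2_eq_square)
  \<comment> \<open>\<open>A > q\<close> makes \<open>A\<close> nonzero, so it has finitely many
    divisors; on an infinite set \<open>card\<close> would be 0.\<close>
  moreover have "finite {r. prime r \<and> r dvd A}"
    using \<open>A > q\<close> by (auto intro!: finite_subset[OF _ finite_divisors_nat[of A]])
  ultimately have "card {q, s} \<le> card {r. prime r \<and> r dvd A}"
    using assms(1) qA s m by (intro card_mono) auto
  hence "card {r. prime r \<and> r dvd A} \<ge> 2"
    using \<open>s \<noteq> q\<close> by simp
  thus ?thesis
    using assms(1) qA p(2) uniq by blast
qed

end
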